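(* Let $\mathcal{X},\mathcal{A},p,f,\gamma,h$ and the iterates $(\mu_k,Q_{h,k})_{k\ge 0}$ be as in the context, with fixed learning rates $\rho^\mu,\rho^Q>0$, and suppose that Assumptions (F), (P) and (D) of the context hold. Suppose that $$0<\rho^{\mu}<\frac{1}{2\beta-1-L_p},\qquad 0<\rho^Q<\frac{1}{1-e^{-\gamma h}}.$$ Put $\Lambda_{\mu}=1-\rho^{\mu}(2\beta-1-L_p)$, let $W>0$, and let $c=\min\{c_1,c_2\}$, where $$c_1=\rho^Q\Big(1-e^{-\gamma h}-\Big(L_f+\frac{L_p\|f\|_\infty}{e^{\gamma h}-1}\Big)\frac{hL_Q}{2\beta-1-L_p}\Big)-\frac{2\Lambda_\mu L_Q}{W(2\beta-1-L_p)},$$ $$c_2=1-\Lambda_\mu-W\rho^Q h\Big(L_f+\frac{L_p\|f\|_\infty}{e^{\gamma h}-1}\Big).$$ Assume that $W$ and the parameters are such that $c>0$. Then the Lyapunov function $$\mathcal{L}_k=W\min_{Q_h^*\in F}\|Q_{h,k}-Q_h^*\|_\infty+\|\mu_k-\tilde\mu_k\|_{\mathrm{TV}}$$ satisfies, for every $k\ge 0$, $$\mathcal{L}_k\le(1-c)^k\mathcal{L}_0+\frac{2h\Lambda_\mu L_Q\rho^Q\|f\|_\infty}{c(1-e^{-\gamma h})(2\beta-1-L_p)}.$$ As $k\to\infty$ one has $\mathcal{L}_\infty=O(\rho^Q)$, in the sense that $\limsup_{k\to\infty}\mathcal{L}_k\le C\rho^Q$ with $C=\frac{2h\Lambda_\mu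 L_Q\|f\|_\infty}{c(1-e^{-\gamma h})(2\beta-1-L_p)}$.
   Context: $\mathcal{X}$ and $\mathcal{A}$ are finite nonempty sets (states, actions), $\mathcal{P}(\mathcal{X})$ is the set of probability measures on $\mathcal{X}$, $\gamma>0$ and $h>0$ are constants, $p(x'\mid x,a,\mu)$ is a transition kernel (for each $(x,a,\mu)\in\mathcal{X}\times\mathcal{A}\times\mathcal{P}(\mathcal{X})$, $p(\cdot\mid x,a,\mu)\in\mathcal{P}(\mathcal{X})$), and $f:\mathcal{X}\times\mathcal{A}\times\mathcal{P}(\mathcal{X})\to\mathbb{R}_+$ is a running cost. Norms: $\|Q\|_\infty=\sup_{x,a}|Q(x,a)|$; $\|f\|_\infty=\sup_{x,a,\mu}|f(x,a,\mu)|$; for a signed measure $\mu$ on $\mathcal{X}$, $\|\mu\|_{\mathrm{TV}}=\sup_{A\subseteq\mathcal{X}}\big|\sum_{x\in A}\mu(x)\big|$. For $Q:\mathcal{X}\times\mathcal{A}\to\mathbb{R}$ and $\mu\in\mathcal{P}(\mathcal{X})$, $P^{Q,\mu}(x,x')=p(x'\mid x,\arg\min_a Q(x,a),\mu)$ (where $\arg\min_a$ denotes a selected minimizer), and $(\mu P^{Q,\mu})(x)=\sum_{x_0}\mu(x_0)P^{Q,\mu}(x_0,x)$. Two-timescale Q-learning iteration: starting from an initial guess $(Q_{h,0},\mu_0)$, with $\mu_0\in\mathcal{P}(\mathcal{X})$, for $k\ge0$, $$\mu_{k+1}=\mu_k+\rho^\mu\big(\mu_kP^{Q_{h,k},\mu_k}-\mu_k\big),$$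 $$Q_{h,k+1}(x,a)=Q_{h,k}(x,a)+\rho^Q\Big(hf(x,a,\mu_k)+e^{-\gamma h}\sum_{x'}p(x'\mid x,a,\mu_k)\min_{a'}Q_{h,k}(x',a')-Q_{h,k}(x,a)\Big).$$ $F$ is the set of functions $Q_h^*$ for which there is $\tilde\mu^*\in\mathcal{P}(\mathcal{X})$ with $Q_h^*(x,a)=hf(x,a,\tilde\mu^* )+e^{-\gamma h}\sum_{x'}p(x'\mid x,a,\tilde\mu^* )\min_{a'}Q_h^*(x',a')$ for all $(x,a)$ and $\tilde\mu^*=\tilde\mu^*P^{Q_h^*,\tilde\mu^*}$. For each $k$, $\tilde\mu_k\in\mathcal{P}(\mathcal{X})$ is the equilibrium distribution corresponding to $Q_{h,k}$, i.e. $\tilde\mu_k=\tilde\mu_kP^{Q_{h,k},\tilde\mu_k}$. Assumption (F): $f$ is bounded and there is $L_f>0$ with $|f(x,a,\mu_1)-f(x,a,\mu_2)|\le L_f\|\mu_1-\mu_2\|_{\mathrm{TV}}$ for all $x,a,\mu_1,\mu_2$. Assumption (P): there are $0<L_p<1$ and $L_Q>0$ such that for all $x\in\mathcal{X}$, $\mu_1,\mu_2\in\mathcal{P}(\mathcal{X})$ and all $Q_1,Q_2$, $\sum_{x'\in\mathcal{X}}|P^{Q_1,\mu_1}(x,x')-P^{Q_2,\mu_2}(x,x')|\le L_p\|\mu_1-\mu_2\|_{\mathrm{TV}}+L_Q\|Q_1-Q_2\|_\infty$. Assumption (D) (uniform Doeblin condition): for any bounded $Q$ the transition probability has an equilibrium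 probability measure $\pi$ solving $\pi=\pi P^{Q,\pi}$, and there exist a constant $\beta\in\big(\frac{1+L_p}{2},1\big)$ and a probability measure $\nu$ (independent of $Q$) such that $P^{Q,\pi}(x,\cdot)\ge\beta\nu(\cdot)$ for all $x\in\mathcal{X}$.
   Formalization: The learning rates are additionally assumed to satisfy ρ^μ ≤ 1 and ρ^Q ≤ 1; with only the printed upper bounds, which exceed 1, the claim is false (e.g. one action, uniform p, f = 0, ρ^Q = 2, e^{-γh} = 0.6, ρ^μ = 1). *)

theory Defs
  imports "HOL-Probability.Probability"
begin

text \<open>
  States and actions are the types \<open>'x\<close>, \<open>'a\<close> of class \<open>finite\<close> (hence finite and nonempty), and
  probability measures on the state space are elements of \<open>'x pmf\<close>.  Every
  \<open>Q :: 'x \<Rightarrow> 'a \<Rightarrow> real\<close> is therefore bounded.  The argument \<open>sel\<close> below is a selection of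
  minimizers: \<open>sel Q x\<close> plays the role of the minimizing action of \<open>Q x\<close>.
\<close>

definition minimizer_selection :: "(('x \<Rightarrow> 'a \<Rightarrow> real) \<Rightarrow> 'x \<Rightarrow> 'a) \<Rightarrow> bool" where
  "minimizer_selection sel \<longleftrightarrow> (\<forall>Q x. is_arg_min (Q x) (\<lambda>_. True) (sel Q x))"

definition Q_norm :: "('x::finite \<Rightarrow> 'a::finite \<Rightarrow> real) \<Rightarrow> real" where
  "Q_norm Q = (SUP (x, a). \<bar>Q x a\<bar>)"

text \<open>The supremum below is meaningful only for bounded \<open>f\<close>, which \<open>assumption_F\<close> provides.\<close>

definition cost_norm :: "('x::finite \<Rightarrow> 'a::finite \<Rightarrow> 'x pmf \<Rightarrow> real) \<Rightarrow> real" where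
  "cost_norm f = (SUP (x, a, \<mu>). \<bar>f x a \<mu>\<bar>)"

text \<open>
  Signed measures are given by their mass functions.  No factor is hidden here: for a difference
  of two probability measures this norm is half the \<open>l\<^sup>1\<close> norm.
\<close>

definition tv_norm :: "('x::finite \<Rightarrow> real) \<Rightarrow> real" where
  "tv_norm m = (SUP A. \<bar>\<Sum>x\<in>A. m x\<bar>)"

definition tv_dist :: "'x::finite pmf \<Rightarrow> 'x pmf \<Rightarrow> real" where
  "tv_dist \<mu> \<nu> = tv_norm (\<lambda>x. pmf \<mu> x - pmf \<nu> x)"

definition greedy_kernel ::
  "('x::finite \<Rightarrow> 'a::finite \<Rightarrow> 'x pmf \<Rightarrow> 'x pmf) \<Rightarrow> (('x \<Rightarrow> 'a \<Rightarrow> real) \<Rightarrow> 'x \<Rightarrow> 'a)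
    \<Rightarrow> ('x \<Rightarrow> 'a \<Rightarrow> real) \<Rightarrow> 'x pmf \<Rightarrow> 'x \<Rightarrow> 'x \<Rightarrow> real" where
  "greedy_kernel p sel Q \<mu> x x' = pmf (p x (sel Q x) \<mu>) x'"

definition push :: "'x::finite pmf \<Rightarrow> ('x \<Rightarrow> 'x \<Rightarrow> real) \<Rightarrow> 'x \<Rightarrow> real" where
  "push \<mu> P x = (\<Sum>x0\<in>UNIV. pmf \<mu> x0 * P x0 x)"

definition equilibrium ::
  "('x::finite \<Rightarrow> 'a::finite \<Rightarrow> 'x pmf \<Rightarrow> 'x pmf) \<Rightarrow> (('x \<Rightarrow> 'a \<Rightarrow> real) \<Rightarrow> 'x \<Rightarrow> 'a)
    \<Rightarrow> ('x \<Rightarrow> 'a \<Rightarrow> real) \<Rightarrow> 'x pmf \<Rightarrow> bool" where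
  "equilibrium p sel Q \<pi> \<longleftrightarrow> pmf \<pi> = push \<pi> (greedy_kernel p sel Q \<pi>)"

definition bellman ::
  "('x::finite \<Rightarrow> 'a::finite \<Rightarrow> 'x pmf \<Rightarrow> 'x pmf) \<Rightarrow> ('x \<Rightarrow> 'a \<Rightarrow> 'x pmf \<Rightarrow> real)
    \<Rightarrow> real \<Rightarrow> real \<Rightarrow> 'x pmf \<Rightarrow> ('x \<Rightarrow> 'a \<Rightarrow> real) \<Rightarrow> 'x \<Rightarrow> 'a \<Rightarrow> real" where
  "bellman p f \<gamma> h \<mu> Q x a =
     h * f x a \<mu> + exp (- \<gamma> * h) * (\<Sum>x'\<in>UNIV. pmf (p x a \<mu>) x' * (MIN a'. Q x' a'))"

text \<open>Fixed points of the Bellman operator whose measure argument is their own equilibrium.\<close>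

definition mean_field_solutions ::
  "('x::finite \<Rightarrow> 'a::finite \<Rightarrow> 'x pmf \<Rightarrow> 'x pmf) \<Rightarrow> (('x \<Rightarrow> 'a \<Rightarrow> real) \<Rightarrow> 'x \<Rightarrow> 'a)
    \<Rightarrow> ('x \<Rightarrow> 'a \<Rightarrow> 'x pmf \<Rightarrow> real) \<Rightarrow> real \<Rightarrow> real \<Rightarrow> ('x \<Rightarrow> 'a \<Rightarrow> real) set" where
  "mean_field_solutions p sel f \<gamma> h =
     {Q. \<exists>\<mu>. (\<forall>x a. Q x a = bellman p f \<gamma> h \<mu> Q x a) \<and> equilibrium p sel Q \<mu>}"

text \<open>
  Requiring the iterates to be probability measures is automatic for \<open>0 < \<rho>\<mu> \<le> 1\<close>, where the update
  is a convex combination; for other rates it is a genuine restriction.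
\<close>

definition two_timescale_iterates ::
  "('x::finite \<Rightarrow> 'a::finite \<Rightarrow> 'x pmf \<Rightarrow> 'x pmf) \<Rightarrow> (('x \<Rightarrow> 'a \<Rightarrow> real) \<Rightarrow> 'x \<Rightarrow> 'a)
    \<Rightarrow> ('x \<Rightarrow> 'a \<Rightarrow> 'x pmf \<Rightarrow> real) \<Rightarrow> real \<Rightarrow> real \<Rightarrow> real \<Rightarrow> real
    \<Rightarrow> (nat \<Rightarrow> 'x pmf) \<Rightarrow> (nat \<Rightarrow> 'x \<Rightarrow> 'a \<Rightarrow> real) \<Rightarrow> bool" where
  "two_timescale_iterates p sel f \<gamma> h \<rho>\<mu> \<rho>Q \<mu> Q \<longleftrightarrow>
     (\<forall>k x. pmf (\<mu> (Suc k)) x =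
        pmf (\<mu> k) x + \<rho>\<mu> * (push (\<mu> k) (greedy_kernel p sel (Q k) (\<mu> k)) x - pmf (\<mu> k) x)) \<and>
     (\<forall>k x a. Q (Suc k) x a =
        Q k x a + \<rho>Q * (bellman p f \<gamma> h (\<mu> k) (Q k) x a - Q k x a))"

definition assumption_F :: "('x::finite \<Rightarrow> 'a::finite \<Rightarrow> 'x pmf \<Rightarrow> real) \<Rightarrow> real \<Rightarrow> bool" where
  "assumption_F f L\<^sub>f \<longleftrightarrow>
     bounded (range (\<lambda>(x, a, \<mu>). f x a \<mu>)) \<and> L\<^sub>f > 0 \<and>
     (\<forall>x a \<mu>1 \<mu>2. \<bar>f x a \<mu>1 - f x a \<mu>2\<bar> \<le> L\<^sub>f * tv_dist \<mu>1 \<mu>2)"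

definition assumption_P ::
  "('x::finite \<Rightarrow> 'a::finite \<Rightarrow> 'x pmf \<Rightarrow> 'x pmf) \<Rightarrow> (('x \<Rightarrow> 'a \<Rightarrow> real) \<Rightarrow> 'x \<Rightarrow> 'a)
    \<Rightarrow> real \<Rightarrow> real \<Rightarrow> bool" where
  "assumption_P p sel L\<^sub>p L\<^sub>Q \<longleftrightarrow>
     0 < L\<^sub>p \<and> L\<^sub>p < 1 \<and> L\<^sub>Q > 0 \<and>
     (\<forall>x \<mu>1 \<mu>2 Q1 Q2.
        (\<Sum>x'\<in>UNIV. \<bar>greedy_kernel p sel Q1 \<mu>1 x x' - greedy_kernel p sel Q2 \<mu>2 x x'\<bar>)
          \<le> L\<^sub>p * tv_dist \<mu>1 \<mu>2 + L\<^sub>Q * Q_norm (\<lambda>x a. Q1 x a - Q2 x a))"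

text \<open>Both \<open>\<beta>\<close> and \<open>\<nu>\<close> are uniform in \<open>Q\<close>; on a finite space the minorization is pointwise.\<close>

definition assumption_D ::
  "('x::finite \<Rightarrow> 'a::finite \<Rightarrow> 'x pmf \<Rightarrow> 'x pmf) \<Rightarrow> (('x \<Rightarrow> 'a \<Rightarrow> real) \<Rightarrow> 'x \<Rightarrow> 'a)
    \<Rightarrow> real \<Rightarrow> real \<Rightarrow> bool" where
  "assumption_D p sel L\<^sub>p \<beta> \<longleftrightarrow>
     (1 + L\<^sub>p) / 2 < \<beta> \<and> \<beta> < 1 \<and>
     (\<exists>\<nu> :: 'x pmf. \<forall>Q. \<exists>\<pi>. equilibrium p sel Q \<pi> \<and>
        (\<forall>x x'. \<beta> * pmf \<nu> x' \<le> greedy_kernel p sel Q \<pi> x x'))"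

text \<open>
  The minimum over \<open>S\<close> is rendered as an infimum, so it is to be used together with the fact that
  \<open>S\<close> has an element nearest to \<open>Q\<close> (in particular, that \<open>S\<close> is nonempty).
\<close>

definition lyapunov ::
  "real \<Rightarrow> ('x::finite \<Rightarrow> 'a::finite \<Rightarrow> real) set \<Rightarrow> ('x \<Rightarrow> 'a \<Rightarrow> real) \<Rightarrow> 'x pmf \<Rightarrow> 'x pmf
    \<Rightarrow> real" where
  "lyapunov W S Q \<mu> \<mu>t = W * (INF Qs\<in>S. Q_norm (\<lambda>x a. Q x a - Qs x a)) + tv_dist \<mu> \<mu>t"

end

theory Submission
  imports Defs
begin

text \<open>
  Why the theorem holds.  Assumption (P) asks the greedy kernel to be Lipschitz in \<open>Q\<close>, but the
  greedy kernel depends on \<open>Q\<close> only through the selected minimizers, and the set of minimizers is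
  unchanged when \<open>Q\<close> is multiplied by a small positive number.  Given two actions \<open>a\<close> and \<open>b\<close>, there are \<open>Q\<^sub>1\<close>,
  \<open>Q\<^sub>2\<close> of arbitrarily small norm whose only minimizers are \<open>a\<close> and \<open>b\<close>; the Lipschitz bound then
  forces \<open>p x a m = p x b m\<close> (lemma \<open>kernel_action_independent\<close>).  So under (P) the actions
  influence only the cost, and the greedy kernel is the same for every \<open>Q\<close>.

  This decouples the two time scales.  By the Doeblin minorization,
  \<open>m \<mapsto> m P\<^sup>m\<close> moves every \<open>m\<close> closer to an equilibrium \<open>\<pi>\<close> by a factor \<open>1 - \<beta> + L\<^sub>p < 1\<close>
  (lemma \<open>push_contraction\<close>), so that \<open>\<pi>\<close> is unique and is the equilibrium \<open>\<mu>t k\<close> of every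
  iterate.  Because \<open>1 - \<beta> + L\<^sub>p \<le> 1 - (2 * \<beta> - 1 - L\<^sub>p)\<close>, the distances
  \<open>\<delta>\<^sub>k = tv_dist (\<mu> k) \<pi>\<close> satisfy \<open>\<delta>\<^sub>k\<^sub>+\<^sub>1 \<le> \<Lambda> \<delta>\<^sub>k\<close>.

  The only mean field solution is the fixed point \<open>Q\<^sup>*\<close> of the Bellman contraction at \<open>\<pi>\<close>
  (lemma \<open>mean_field_solutions_singleton\<close>), and the Lipschitz estimate
  \<open>bellman_lipschitz\<close> gives, for \<open>d\<^sub>k = Q_norm (Q\<^sub>k - Q\<^sup>*)\<close>,
  \<open>d\<^sub>k\<^sub>+\<^sub>1 \<le> (1 - \<rho>Q (1 - exp (- \<gamma> h))) d\<^sub>k + \<rho>Q h K \<delta>\<^sub>k\<close> where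
  \<open>K = L\<^sub>f + L\<^sub>p * cost_norm f / (exp (\<gamma> h) - 1)\<close>.
  Adding \<open>W\<close> times the second recursion to the first yields \<open>L\<^sub>k\<^sub>+\<^sub>1 \<le> (1 - c) L\<^sub>k\<close>.  So
  \<open>L\<^sub>k\<close> tends to \<open>0\<close> geometrically, and the asserted bounds exceed this by a nonnegative term.
\<close>

section \<open>The total variation norm\<close>

lemma abs_sum_le_tv_norm:
  fixes m :: "'x::finite \<Rightarrow> real"
  shows "\<bar>sum m A\<bar> \<le> tv_norm m"
  unfolding tv_norm_def by (rule cSUP_upper) auto

lemma tv_norm_le:
  fixes m :: "'x::finite \<Rightarrow> real"
  assumes "\<And>A. \<bar>sum m A\<bar> \<le> B"
  shows "tv_norm m \<le> B"
  unfolding tv_norm_def by (rule cSUP_least) (use assms in auto)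

lemma tv_dist_nonneg: "0 \<le> tv_dist \<mu> \<nu>"
  unfolding tv_dist_def using abs_sum_le_tv_norm[of _ "{}"] by simp

lemma tv_dist_self [simp]: "tv_dist \<mu> \<mu> = 0"
  by (simp add: tv_dist_def tv_norm_def)

lemma tv_dist_eq_0_imp_eq:
  assumes "tv_dist \<mu> \<nu> \<le> 0"
  shows "\<mu> = \<nu>"
proof (rule pmf_eqI)
  fix x
  have "\<bar>pmf \<mu> x - pmf \<nu> x\<bar> \<le> 0"
    using abs_sum_le_tv_norm[of "\<lambda>x. pmf \<mu> x - pmf \<nu> x" "{x}"] assms
    by (simp add: tv_dist_def)
  then show "pmf \<mu> x = pmf \<nu> x" by simp
qed

text \<open>
  Integrating against weights in \<open>[0, b]\<close> is at most \<open>b\<close> times the larger of the positive and the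
  negative mass, and each of these is the mass of a set.
\<close>

lemma abs_weighted_sum_le_tv_norm:
  fixes m g :: "'x::finite \<Rightarrow> real"
  assumes "\<And>x. 0 \<le> g x" and "\<And>x. g x \<le> b"
  shows "\<bar>\<Sum>x\<in>UNIV. m x * g x\<bar> \<le> b * tv_norm m"
proof -
  have upper: "(\<Sum>x\<in>UNIV. n x * g x) \<le> b * sum n {x. 0 < n x}" for n :: "'x \<Rightarrow> real"
  proof -
    have "(\<Sum>x\<in>UNIV. n x * g x) \<le> (\<Sum>x\<in>UNIV. if 0 < n x then b * n x else 0)"
    proof (rule sum_mono)
      fix x
      show "n x * g x \<le> (if 0 < n x then b * n x else 0)"
        using assms[of x] by (auto simp: mult.commute[of b] mult_left_mono mult_nonpos_nonneg)
    qed
    also have "\<dots> = (\<Sum>x\<in>{x. 0 < n x}. b * n x)"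
      by (simp add: sum.If_cases)
    finally show ?thesis by (simp add: sum_distrib_left)
  qed
  have "0 \<le> b" using assms[of undefined] by linarith
  have "(\<Sum>x\<in>UNIV. m x * g x) \<le> b * tv_norm m"
    using upper[of m] mult_left_mono[OF _ \<open>0 \<le> b\<close>] abs_sum_le_tv_norm[of m]
    by (meson abs_le_D1 order_trans)
  moreover have "- (\<Sum>x\<in>UNIV. m x * g x) \<le> b * tv_norm m"
  proof -
    have "- (\<Sum>x\<in>UNIV. m x * g x) \<le> b * (- sum m {x. m x < 0})"
      using upper[of "\<lambda>x. - m x"] by (simp add: sum_negf)
    also have "\<dots> \<le> b * tv_norm m"
      using abs_sum_le_tv_norm[of m "{x. m x < 0}"] \<open>0 \<le> b\<close> by (intro mult_left_mono) auto
    finally show ?thesis .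
  qed
  ultimately show ?thesis by linarith
qed

text \<open>
  Since \<open>\<mu>\<close> and \<open>\<nu>\<close> have the same mass, subtracting \<open>\<beta> * pmf \<xi>\<close> from every row of the
  kernel does not change the difference below; the rows that are left have mass \<open>1 - \<beta>\<close>.
\<close>

lemma push_diff_Doeblin:
  fixes \<mu> \<nu> \<xi> :: "'x::finite pmf" and R :: "'x \<Rightarrow> 'x pmf"
  assumes "\<And>x x'. \<beta> * pmf \<xi> x' \<le> pmf (R x) x'"
  shows "tv_norm (\<lambda>x. push \<mu> (\<lambda>x0 x. pmf (R x0) x) x - push \<nu> (\<lambda>x0 x. pmf (R x0) x) x)
    \<le> (1 - \<beta>) * tv_dist \<mu> \<nu>"
proof (rule tv_norm_le)
  fix A :: "'x set"
  define g where "g x0 = (\<Sum>x\<in>A. pmf (R x0) x - \<beta> * pmf \<xi> x)" for x0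
  have mass: "(\<Sum>x\<in>UNIV. pmf m x) = 1" for m :: "'x pmf"
    by (rule sum_pmf_eq_1) auto
  have g: "0 \<le> g x0" "g x0 \<le> 1 - \<beta>" for x0
  proof -
    show "0 \<le> g x0" unfolding g_def using assms by (intro sum_nonneg) simp
    have "g x0 \<le> (\<Sum>x\<in>UNIV. pmf (R x0) x - \<beta> * pmf \<xi> x)"
      unfolding g_def using assms by (intro sum_mono2) auto
    then show "g x0 \<le> 1 - \<beta>"
      by (simp add: sum_subtractf mass flip: sum_distrib_left)
  qed
  have "(\<Sum>x\<in>A. push \<mu> (\<lambda>x0 x. pmf (R x0) x) x - push \<nu> (\<lambda>x0 x. pmf (R x0) x) x)
    = (\<Sum>x0\<in>UNIV. (pmf \<mu> x0 - pmf \<nu> x0) * (\<Sum>x\<in>A. pmf (R x0) x))"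
    unfolding push_def sum_subtractf[symmetric] sum_distrib_left
    by (subst sum.swap) (simp add: left_diff_distrib)
  also have "\<dots> = (\<Sum>x0\<in>UNIV. (pmf \<mu> x0 - pmf \<nu> x0) * g x0
      + (pmf \<mu> x0 - pmf \<nu> x0) * (\<beta> * sum (pmf \<xi>) A))"
    by (simp add: g_def sum_subtractf right_diff_distrib sum_distrib_left)
  also have "\<dots> = (\<Sum>x0\<in>UNIV. (pmf \<mu> x0 - pmf \<nu> x0) * g x0)"
    by (simp add: sum.distrib sum_subtractf mass flip: sum_distrib_right)
  finally show "\<bar>\<Sum>x\<in>A. push \<mu> (\<lambda>x0 x. pmf (R x0) x) x - push \<nu> (\<lambda>x0 x. pmf (R x0) x) x\<bar>
      \<le> (1 - \<beta>) * tv_dist \<mu> \<nu>"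
    unfolding tv_dist_def using abs_weighted_sum_le_tv_norm[OF g] by simp
qed

section \<open>The supremum norm\<close>

lemma abs_le_Q_norm: "\<bar>R x a\<bar> \<le> Q_norm R"
proof -
  have "(\<lambda>(x, a). \<bar>R x a\<bar>) (x, a) \<le> Q_norm R"
    unfolding Q_norm_def by (rule cSUP_upper) auto
  then show ?thesis by simp
qed

lemma Q_norm_le:
  assumes "\<And>x a. \<bar>R x a\<bar> \<le> B"
  shows "Q_norm R \<le> B"
  unfolding Q_norm_def by (rule cSUP_least) (use assms in auto)

lemma Q_norm_nonneg: "0 \<le> Q_norm R"
  using abs_le_Q_norm[of R] abs_ge_zero order_trans by blast

lemma abs_Min_diff_le_Q_norm:
  "\<bar>(MIN a. R x a) - (MIN a. S x a)\<bar> \<le> Q_norm (\<lambda>x a. R x a - S x a)"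
proof -
  have le: "(MIN a. R x a) \<le> (MIN a. S x a) + Q_norm (\<lambda>x a. R x a - S x a)"
    for R S :: "'x::finite \<Rightarrow> 'a::finite \<Rightarrow> real" and x
  proof -
    have "(MIN a. S x a) \<in> range (S x)" by (rule Min_in) auto
    then obtain b where b: "(MIN a. S x a) = S x b" by blast
    have "(MIN a. R x a) \<le> R x b" by simp
    then show ?thesis
      using abs_le_Q_norm[of "\<lambda>x a. R x a - S x a" x b] b by linarith
  qed
  have "Q_norm (\<lambda>x a. R x a - S x a) = Q_norm (\<lambda>x a. S x a - R x a)"
    by (simp add: Q_norm_def abs_minus_commute)
  then show ?thesis using le[of R x S] le[of S x R] by linarith
qed

text \<open>
  Banach's fixed point theorem for the norm \<open>Q_norm\<close>: the increments of the iteration started at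
  \<open>0\<close> are dominated by a geometric series, and the fixed point is their sum.
\<close>

lemma Q_norm_contraction_fixpoint:
  fixes T :: "('x::finite \<Rightarrow> 'a::finite \<Rightarrow> real) \<Rightarrow> 'x \<Rightarrow> 'a \<Rightarrow> real"
  assumes "0 \<le> e" and "e < 1"
    and contr: "\<And>R S. Q_norm (\<lambda>x a. T R x a - T S x a) \<le> e * Q_norm (\<lambda>x a. R x a - S x a)"
  obtains R where "T R = R"
proof -
  define it where "it n = (T ^^ n) (\<lambda>_ _. 0)" for n
  have it_Suc: "it (Suc n) = T (it n)" for n by (simp add: it_def)
  define D where "D = Q_norm (\<lambda>x a. it 1 x a - it 0 x a)"
  have inc: "Q_norm (\<lambda>x a. it (Suc n) x a - it n x a) \<le> D * e ^ n" for n
  proof (induction n)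
    case 0
    show ?case by (simp add: D_def)
  next
    case (Suc n)
    have "Q_norm (\<lambda>x a. it (Suc (Suc n)) x a - it (Suc n) x a)
      \<le> e * Q_norm (\<lambda>x a. it (Suc n) x a - it n x a)"
      unfolding it_Suc[of "Suc n"] it_Suc[of n] by (rule contr)
    also have "\<dots> \<le> e * (D * e ^ n)" using Suc \<open>0 \<le> e\<close> by (rule mult_left_mono)
    finally show ?case by (simp add: ac_simps)
  qed
  define R where "R x a = (\<Sum>n. it (Suc n) x a - it n x a)" for x a
  have lim: "(\<lambda>n. it n x a) \<longlonglongrightarrow> R x a" for x a
  proof -
    have "summable (\<lambda>n. it (Suc n) x a - it n x a)"
    proof (rule summable_comparison_test')
      show "summable (\<lambda>n. D * e ^ n)" using assms by (intro summable_mult summable_geometric) auto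
      show "norm (it (Suc n) x a - it n x a) \<le> D * e ^ n" if "0 \<le> n" for n
        using inc[of n] abs_le_Q_norm[of "\<lambda>x a. it (Suc n) x a - it n x a" x a] by simp
    qed
    from summable_LIMSEQ[OF this] have "(\<lambda>n. it n x a - it 0 x a) \<longlonglongrightarrow> R x a"
      by (simp only: sum_lessThan_telescope[of "\<lambda>n. it n x a"] R_def)
    then show ?thesis by (simp add: it_def)
  qed
  have "T R x a = R x a" for x a
  proof (rule LIMSEQ_unique)
    show "(\<lambda>n. it (Suc n) x a) \<longlonglongrightarrow> R x a" by (rule LIMSEQ_Suc[OF lim])
    \<comment> \<open>The sum over the finite domain dominates the norm and visibly tends to \<open>0\<close>.\<close>
    define s where "s n = (\<Sum>y\<in>UNIV. \<Sum>b\<in>UNIV. \<bar>it n y b - R y b\<bar>)" for n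
    have "s \<longlonglongrightarrow> (\<Sum>y\<in>(UNIV :: 'x set). \<Sum>b\<in>(UNIV :: 'a set). \<bar>R y b - R y b\<bar>)"
      unfolding s_def[abs_def] by (intro tendsto_intros lim)
    then have lim0: "(\<lambda>n. e * s n) \<longlonglongrightarrow> 0"
      by (intro tendsto_mult_right_zero) simp
    have le: "norm (it (Suc n) x a - T R x a) \<le> e * s n" for n
    proof -
      have "Q_norm (\<lambda>y b. it n y b - R y b) \<le> s n"
      proof (rule Q_norm_le)
        fix y b
        have "\<bar>it n y b - R y b\<bar> \<le> (\<Sum>b\<in>UNIV. \<bar>it n y b - R y b\<bar>)"
          by (rule member_le_sum[of b UNIV "\<lambda>b. \<bar>it n y b - R y b\<bar>"]) auto
        also have "\<dots> \<le> s n" unfolding s_def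
          by (rule member_le_sum[of y UNIV "\<lambda>y. \<Sum>b\<in>UNIV. \<bar>it n y b - R y b\<bar>"])
            (auto intro: sum_nonneg)
        finally show "\<bar>it n y b - R y b\<bar> \<le> s n" .
      qed
      then have "e * Q_norm (\<lambda>y b. it n y b - R y b) \<le> e * s n"
        using \<open>0 \<le> e\<close> by (rule mult_left_mono)
      then show ?thesis unfolding it_Suc real_norm_def
        using contr[of "it n" R] abs_le_Q_norm[of "\<lambda>x a. T (it n) x a - T R x a" x a] by linarith
    qed
    have "(\<lambda>n. it (Suc n) x a - T R x a) \<longlonglongrightarrow> 0"
      by (rule Lim_null_comparison[OF always_eventually lim0]) (use le in blast)
    then show "(\<lambda>n. it (Suc n) x a) \<longlonglongrightarrow> T R x a" by (rule LIM_zero_cancel)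
  qed
  then show ?thesis using that by blast
qed

section \<open>The kernel does not depend on the action\<close>

text \<open>
  The function equal to \<open>0\<close> at \<open>a\<close> and to \<open>t > 0\<close> at every other action has \<open>a\<close> as its only
  minimizer.  Two such functions are at distance at most \<open>t\<close>, so (P) bounds the distance of the two
  transition probabilities by \<open>L\<^sub>Q * t\<close> for every \<open>t > 0\<close>.
\<close>

lemma kernel_action_independent:
  fixes p :: "'x::finite \<Rightarrow> 'a::finite \<Rightarrow> 'x pmf \<Rightarrow> 'x pmf"
  assumes sel: "minimizer_selection sel" and P: "assumption_P p sel L\<^sub>p L\<^sub>Q"
  shows "p x a m = p x b m"
proof (rule pmf_eqI)
  fix x'
  define R where "R t c = (\<lambda>(_ :: 'x) c'. if c' = c then 0 else t)" for t :: real and c :: 'a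
  have sel_R: "sel (R t c) x = c" if "0 < t" for t c
  proof (rule ccontr)
    assume "sel (R t c) x \<noteq> c"
    then have "R t c x c < R t c x (sel (R t c) x)" using that by (simp add: R_def)
    then show False using sel by (auto simp: minimizer_selection_def is_arg_min_def)
  qed
  have "\<bar>pmf (p x a m) x' - pmf (p x b m) x'\<bar> \<le> 0"
  proof (rule field_le_epsilon)
    fix \<epsilon> :: real assume "0 < \<epsilon>"
    have "0 < L\<^sub>Q" using P by (simp add: assumption_P_def)
    define t where "t = \<epsilon> / L\<^sub>Q"
    have "0 < t" using \<open>0 < \<epsilon>\<close> \<open>0 < L\<^sub>Q\<close> by (simp add: t_def)
    have "\<bar>pmf (p x a m) x' - pmf (p x b m) x'\<bar>
      \<le> (\<Sum>x'\<in>UNIV. \<bar>pmf (p x a m) x' - pmf (p x b m) x'\<bar>)"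
      by (rule member_le_sum[of x' UNIV "\<lambda>x'. \<bar>pmf (p x a m) x' - pmf (p x b m) x'\<bar>"]) auto
    also have "\<dots> = (\<Sum>x'\<in>UNIV. \<bar>greedy_kernel p sel (R t a) m x x'
        - greedy_kernel p sel (R t b) m x x'\<bar>)"
      using sel_R[OF \<open>0 < t\<close>] by (simp add: greedy_kernel_def)
    also have "\<dots> \<le> L\<^sub>p * tv_dist m m + L\<^sub>Q * Q_norm (\<lambda>x c. R t a x c - R t b x c)"
      using P unfolding assumption_P_def by blast
    also have "\<dots> \<le> L\<^sub>Q * t"
      using \<open>0 < t\<close> \<open>0 < L\<^sub>Q\<close> by (auto intro!: mult_left_mono Q_norm_le simp: R_def)
    finally show "\<bar>pmf (p x a m) x' - pmf (p x b m) x'\<bar> \<le> 0 + \<epsilon>"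
      using \<open>0 < L\<^sub>Q\<close> by (simp add: t_def)
  qed
  then show "pmf (p x a m) x' = pmf (p x b m) x'" by simp
qed

lemma greedy_kernel_independent:
  assumes "minimizer_selection sel" and "assumption_P p sel L\<^sub>p L\<^sub>Q"
  shows "greedy_kernel p sel R m = greedy_kernel p sel S m"
  unfolding greedy_kernel_def
  using kernel_action_independent[OF assms, of _ "sel R _" _ "sel S _"] by metis

lemma kernel_lipschitz:
  assumes "minimizer_selection sel" and P: "assumption_P p sel L\<^sub>p L\<^sub>Q"
  shows "(\<Sum>x'\<in>UNIV. \<bar>pmf (p x a m1) x' - pmf (p x a m2) x'\<bar>) \<le> L\<^sub>p * tv_dist m1 m2"
proof -
  define Z where "Z = (\<lambda>(_ :: 'a) (_ :: 'b). 0 :: real)"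
  have "(\<Sum>x'\<in>UNIV. \<bar>greedy_kernel p sel Z m1 x x' - greedy_kernel p sel Z m2 x x'\<bar>)
    \<le> L\<^sub>p * tv_dist m1 m2 + L\<^sub>Q * Q_norm (\<lambda>x a. Z x a - Z x a)"
    using P unfolding assumption_P_def by blast
  moreover have "Q_norm (\<lambda>x a. Z x a - Z x a) = 0" by (simp add: Q_norm_def)
  moreover have "pmf (p x a m) = greedy_kernel p sel Z m x" for m
    unfolding greedy_kernel_def using kernel_action_independent[OF assms] by metis
  ultimately show ?thesis by simp
qed

section \<open>The equilibrium distribution\<close>

text \<open>
  Only the kernel at the equilibrium \<open>\<pi>\<close> is minorized.  Hence the comparison goes through
  \<open>push m (greedy_kernel p sel R \<pi>)\<close>: replacing the kernel at \<open>m\<close> by the one at \<open>\<pi>\<close> costs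
  \<open>L\<^sub>p\<close>, replacing the measure costs \<open>1 - \<beta>\<close>.
\<close>

lemma push_contraction:
  fixes p :: "'x::finite \<Rightarrow> 'a::finite \<Rightarrow> 'x pmf \<Rightarrow> 'x pmf"
  assumes sel: "minimizer_selection sel" and P: "assumption_P p sel L\<^sub>p L\<^sub>Q"
    and minor: "\<And>x x'. \<beta> * pmf \<nu> x' \<le> greedy_kernel p sel R \<pi> x x'"
  shows "tv_norm (\<lambda>x. push m (greedy_kernel p sel R m) x - push \<pi> (greedy_kernel p sel R \<pi>) x)
    \<le> (1 - \<beta> + L\<^sub>p) * tv_dist m \<pi>"
proof (rule tv_norm_le)
  fix A :: "'x set"
  let ?P = "greedy_kernel p sel R"
  have mass: "(\<Sum>x\<in>UNIV. pmf m x) = 1" by (rule sum_pmf_eq_1) auto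
  have kernel: "\<bar>\<Sum>x\<in>A. push m (?P m) x - push m (?P \<pi>) x\<bar> \<le> L\<^sub>p * tv_dist m \<pi>"
  proof -
    have "(\<Sum>x\<in>A. push m (?P m) x - push m (?P \<pi>) x)
      = (\<Sum>x0\<in>UNIV. pmf m x0 * (\<Sum>x\<in>A. ?P m x0 x - ?P \<pi> x0 x))"
      unfolding push_def sum_subtractf[symmetric] sum_distrib_left
      by (subst sum.swap) (simp add: right_diff_distrib)
    also have "\<bar>\<dots>\<bar> \<le> (\<Sum>x0\<in>UNIV. pmf m x0 * (L\<^sub>p * tv_dist m \<pi>))"
    proof (rule sum_abs[THEN order_trans], rule sum_mono)
      fix x0
      have "\<bar>\<Sum>x\<in>A. ?P m x0 x - ?P \<pi> x0 x\<bar> \<le> (\<Sum>x\<in>A. \<bar>?P m x0 x - ?P \<pi> x0 x\<bar>)"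
        by (rule sum_abs)
      also have "\<dots> \<le> (\<Sum>x\<in>UNIV. \<bar>?P m x0 x - ?P \<pi> x0 x\<bar>)" by (rule sum_mono2) auto
      also have "\<dots> \<le> L\<^sub>p * tv_dist m \<pi>"
        unfolding greedy_kernel_def by (rule kernel_lipschitz[OF sel P])
      finally show "\<bar>pmf m x0 * (\<Sum>x\<in>A. ?P m x0 x - ?P \<pi> x0 x)\<bar>
          \<le> pmf m x0 * (L\<^sub>p * tv_dist m \<pi>)"
        by (simp add: abs_mult mult_left_mono)
    qed
    also have "\<dots> = L\<^sub>p * tv_dist m \<pi>" by (simp add: mass flip: sum_distrib_right)
    finally show ?thesis .
  qed
  have P_pi: "?P \<pi> = (\<lambda>x0 x. pmf (p x0 (sel R x0) \<pi>) x)"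
    by (intro ext) (simp add: greedy_kernel_def)
  have "\<bar>\<Sum>x\<in>A. push m (?P \<pi>) x - push \<pi> (?P \<pi>) x\<bar> \<le> (1 - \<beta>) * tv_dist m \<pi>"
    unfolding P_pi
    by (rule order_trans[OF abs_sum_le_tv_norm push_diff_Doeblin])
      (use minor in \<open>simp add: greedy_kernel_def\<close>)
  moreover have "(\<Sum>x\<in>A. push m (?P m) x - push \<pi> (?P \<pi>) x)
    = (\<Sum>x\<in>A. push m (?P m) x - push m (?P \<pi>) x)
      + (\<Sum>x\<in>A. push m (?P \<pi>) x - push \<pi> (?P \<pi>) x)"
    by (simp add: sum_subtractf)
  ultimately show "\<bar>\<Sum>x\<in>A. push m (?P m) x - push \<pi> (?P \<pi>) x\<bar>
      \<le> (1 - \<beta> + L\<^sub>p) * tv_dist m \<pi>"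
    using kernel by (simp add: distrib_right)
qed

lemma equilibrium_unique:
  assumes "minimizer_selection sel" and "assumption_P p sel L\<^sub>p L\<^sub>Q"
    and "\<And>x x'. \<beta> * pmf \<nu> x' \<le> greedy_kernel p sel R \<pi> x x'" and "L\<^sub>p < \<beta>"
    and "equilibrium p sel R \<pi>" and "equilibrium p sel R \<pi>'"
  shows "\<pi>' = \<pi>"
proof (rule tv_dist_eq_0_imp_eq)
  have "tv_dist \<pi>' \<pi> \<le> (1 - \<beta> + L\<^sub>p) * tv_dist \<pi>' \<pi>"
    using push_contraction[OF assms(1-3), of \<pi>'] assms(5,6)
    by (simp add: equilibrium_def tv_dist_def)
  then have "(\<beta> - L\<^sub>p) * tv_dist \<pi>' \<pi> \<le> 0" by (simp add: algebra_simps)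
  then show "tv_dist \<pi>' \<pi> \<le> 0"
    using \<open>L\<^sub>p < \<beta>\<close> by (simp add: mult_le_0_iff)
qed

section \<open>The Bellman operator\<close>

lemma abs_expectation_le:
  fixes m :: "'x::finite pmf"
  assumes "\<And>x. \<bar>v x\<bar> \<le> B"
  shows "\<bar>\<Sum>x\<in>UNIV. pmf m x * v x\<bar> \<le> B"
proof -
  have "\<bar>\<Sum>x\<in>UNIV. pmf m x * v x\<bar> \<le> (\<Sum>x\<in>UNIV. pmf m x * B)"
    by (rule sum_abs[THEN order_trans], rule sum_mono) (simp add: abs_mult mult_left_mono assms)
  also have "\<dots> = B" by (simp add: sum_pmf_eq_1 flip: sum_distrib_right)
  finally show ?thesis .
qed

lemma abs_Min_le_Q_norm: "\<bar>MIN a. R x a\<bar> \<le> Q_norm R"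
  using abs_Min_diff_le_Q_norm[of R x "\<lambda>_ _. 0"] by simp

text \<open>
  The change of the kernel is tested against the minimum of the second function \<open>S\<close> alone.  With a
  fixed point of the Bellman operator in that place, \<open>bellman_fixpoint_bound\<close> controls
  \<open>Q_norm S\<close>, and the estimate holds for iterates \<open>R\<close> of any size.
\<close>

lemma bellman_lipschitz:
  assumes F: "assumption_F f L\<^sub>f" and "0 < h"
    and p: "\<And>x a m1 m2. (\<Sum>x'\<in>UNIV. \<bar>pmf (p x a m1) x' - pmf (p x a m2) x'\<bar>) \<le> L\<^sub>p * tv_dist m1 m2"
  shows "\<bar>bellman p f \<gamma> h m1 R x a - bellman p f \<gamma> h m2 S x a\<bar>
    \<le> exp (- \<gamma> * h) * Q_norm (\<lambda>x a. R x a - S x a)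
      + (h * L\<^sub>f + exp (- \<gamma> * h) * L\<^sub>p * Q_norm S) * tv_dist m1 m2"
proof -
  let ?e = "exp (- \<gamma> * h)"
  let ?d = "\<lambda>x'. pmf (p x a m1) x' - pmf (p x a m2) x'"
  define A where "A = (\<Sum>x'\<in>UNIV. pmf (p x a m1) x' * ((MIN b. R x' b) - (MIN b. S x' b)))"
  define B where "B = (\<Sum>x'\<in>UNIV. ?d x' * (MIN b. S x' b))"
  have split: "bellman p f \<gamma> h m1 R x a - bellman p f \<gamma> h m2 S x a
    = h * (f x a m1 - f x a m2) + ?e * A + ?e * B"
    by (simp add: bellman_def A_def B_def algebra_simps sum.distrib sum_subtractf)
  have "\<bar>A\<bar> \<le> Q_norm (\<lambda>x a. R x a - S x a)"
    unfolding A_def by (rule abs_expectation_le) (rule abs_Min_diff_le_Q_norm)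
  then have 1: "\<bar>?e * A\<bar> \<le> ?e * Q_norm (\<lambda>x a. R x a - S x a)"
    by (simp add: abs_mult)
  have "\<bar>B\<bar> \<le> (\<Sum>x'\<in>UNIV. \<bar>?d x'\<bar> * Q_norm S)"
    unfolding B_def
    by (rule sum_abs[THEN order_trans], rule sum_mono)
      (simp add: abs_mult mult_left_mono abs_Min_le_Q_norm)
  also have "\<dots> \<le> L\<^sub>p * tv_dist m1 m2 * Q_norm S"
    unfolding sum_distrib_right[symmetric] by (intro mult_right_mono p Q_norm_nonneg)
  finally have 2: "\<bar>?e * B\<bar> \<le> ?e * (L\<^sub>p * tv_dist m1 m2 * Q_norm S)"
    by (simp add: abs_mult)
  have "\<bar>f x a m1 - f x a m2\<bar> \<le> L\<^sub>f * tv_dist m1 m2"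
    using F by (simp add: assumption_F_def)
  then have 3: "\<bar>h * (f x a m1 - f x a m2)\<bar> \<le> h * (L\<^sub>f * tv_dist m1 m2)"
    using \<open>0 < h\<close> by (simp add: abs_mult)
  show ?thesis unfolding split using 1 2 3 by (simp add: algebra_simps)
qed

lemma abs_cost_le_cost_norm:
  assumes "assumption_F f L\<^sub>f"
  shows "\<bar>f x a m\<bar> \<le> cost_norm f"
proof -
  define g where "g = (\<lambda>(x, a, \<mu>). f x a \<mu>)"
  have "bounded (range g)" using assms unfolding assumption_F_def g_def by (elim conjE)
  then obtain B where B: "norm y \<le> B" if "y \<in> range g" for y unfolding bounded_iff by metis
  have "bdd_above (range (\<lambda>z. \<bar>g z\<bar>))"
  proof (rule bdd_aboveI2)
    show "\<bar>g z\<bar> \<le> B" for z using B[of "g z"] by simp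
  qed
  then have "\<bar>g (x, a, m)\<bar> \<le> (SUP z. \<bar>g z\<bar>)" by (intro cSUP_upper) simp
  also have "(SUP z. \<bar>g z\<bar>) = cost_norm f"
    unfolding cost_norm_def g_def by (simp only: case_prod_unfold)
  finally show ?thesis by (simp add: g_def)
qed

lemma bellman_fixpoint_bound:
  assumes F: "assumption_F f L\<^sub>f" and "0 < \<gamma>" "0 < h"
    and fix_R: "\<And>x a. R x a = bellman p f \<gamma> h m R x a"
  shows "Q_norm R \<le> h * cost_norm f / (1 - exp (- \<gamma> * h))"
proof -
  let ?e = "exp (- \<gamma> * h)"
  have "Q_norm R \<le> h * cost_norm f + ?e * Q_norm R"
  proof (rule Q_norm_le)
    fix x a
    have "\<bar>\<Sum>x'\<in>UNIV. pmf (p x a m) x' * (MIN b. R x' b)\<bar> \<le> Q_norm R"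
      by (rule abs_expectation_le) (rule abs_Min_le_Q_norm)
    then have "\<bar>?e * (\<Sum>x'\<in>UNIV. pmf (p x a m) x' * (MIN b. R x' b))\<bar> \<le> ?e * Q_norm R"
      by (simp add: abs_mult)
    moreover have "\<bar>h * f x a m\<bar> \<le> h * cost_norm f"
      using abs_cost_le_cost_norm[OF F] \<open>0 < h\<close> by (simp add: abs_mult)
    ultimately show "\<bar>R x a\<bar> \<le> h * cost_norm f + ?e * Q_norm R"
      unfolding fix_R[of x a] bellman_def[of p f \<gamma> h m R x a] by linarith
  qed
  moreover have "?e < 1" using assms by simp
  ultimately show ?thesis by (simp add: pos_le_divide_eq algebra_simps)
qed

text \<open>
  All mean field solutions share the equilibrium \<open>\<pi>\<close>, so they are the fixed points of one and the
  same contraction.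
\<close>

lemma mean_field_solutions_singleton:
  assumes F: "assumption_F f L\<^sub>f" and "0 < \<gamma>" "0 < h"
    and p: "\<And>x a m1 m2. (\<Sum>x'\<in>UNIV. \<bar>pmf (p x a m1) x' - pmf (p x a m2) x'\<bar>) \<le> L\<^sub>p * tv_dist m1 m2"
    and eq: "\<And>R m. equilibrium p sel R m \<longleftrightarrow> m = \<pi>"
  obtains S where "mean_field_solutions p sel f \<gamma> h = {S}"
    and "\<And>x a. S x a = bellman p f \<gamma> h \<pi> S x a"
proof -
  let ?e = "exp (- \<gamma> * h)"
  have e: "0 \<le> ?e" "?e < 1" using assms by auto
  have contr: "Q_norm (\<lambda>x a. bellman p f \<gamma> h \<pi> R x a - bellman p f \<gamma> h \<pi> S x a)
      \<le> ?e * Q_norm (\<lambda>x a. R x a - S x a)" for R S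
    using bellman_lipschitz[OF F \<open>0 < h\<close> p, where ?m1.0 = \<pi> and ?m2.0 = \<pi>] by (intro Q_norm_le) simp
  obtain S where S: "bellman p f \<gamma> h \<pi> S = S"
    using Q_norm_contraction_fixpoint[OF e contr] by blast
  have "R = S" if R: "R \<in> mean_field_solutions p sel f \<gamma> h" for R
  proof -
    have "R x a = bellman p f \<gamma> h \<pi> R x a" for x a
      using R eq by (auto simp: mean_field_solutions_def)
    then have "bellman p f \<gamma> h \<pi> R = R" by (intro ext) simp
    then have "Q_norm (\<lambda>x a. R x a - S x a) \<le> ?e * Q_norm (\<lambda>x a. R x a - S x a)"
      using contr[of R S] S by simp
    then have "(1 - ?e) * Q_norm (\<lambda>x a. R x a - S x a) \<le> 0" by (simp add: left_diff_distrib)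
    then have "Q_norm (\<lambda>x a. R x a - S x a) \<le> 0"
      using assms(2,3) by (simp add: mult_le_0_iff)
    then have "R x a = S x a" for x a
      using abs_le_Q_norm[of "\<lambda>x a. R x a - S x a" x a] by simp
    then show "R = S" by blast
  qed
  moreover have "S \<in> mean_field_solutions p sel f \<gamma> h"
    using S eq by (auto simp: mean_field_solutions_def)
  ultimately have "mean_field_solutions p sel f \<gamma> h = {S}" by blast
  then show ?thesis using that S by metis
qed

section \<open>The Lyapunov function decreases geometrically\<close>

theorem theorem5p1:
  fixes p :: "'x::finite \<Rightarrow> 'a::finite \<Rightarrow> 'x pmf \<Rightarrow> 'x pmf"
    and f :: "'x \<Rightarrow> 'a \<Rightarrow> 'x pmf \<Rightarrow> real"
    and sel :: "('x \<Rightarrow> 'a \<Rightarrow> real) \<Rightarrow> 'x \<Rightarrow> 'a"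
    and \<mu> \<mu>t :: "nat \<Rightarrow> 'x pmf"
    and Q :: "nat \<Rightarrow> 'x \<Rightarrow> 'a \<Rightarrow> real"
    and \<gamma> h \<rho>\<mu> \<rho>Q L\<^sub>f L\<^sub>p L\<^sub>Q \<beta> W \<Lambda> c1 c2 c C :: real
    and L :: "nat \<Rightarrow> real"
  assumes "\<gamma> > 0" and "h > 0"
    and "\<And>x a m. f x a m \<ge> 0"
    and "minimizer_selection sel"
    and "assumption_F f L\<^sub>f"
    and "assumption_P p sel L\<^sub>p L\<^sub>Q"
    and "assumption_D p sel L\<^sub>p \<beta>"
    and "two_timescale_iterates p sel f \<gamma> h \<rho>\<mu> \<rho>Q \<mu> Q"
    and "\<And>k. equilibrium p sel (Q k) (\<mu>t k)"
    and "0 < \<rho>\<mu>" and "\<rho>\<mu> \<le> 1" and "\<rho>\<mu> < 1 / (2 * \<beta> - 1 - L\<^sub>p)"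
    and "0 < \<rho>Q" and "\<rho>Q \<le> 1" and "\<rho>Q < 1 / (1 - exp (- \<gamma> * h))"
    and "\<Lambda> = 1 - \<rho>\<mu> * (2 * \<beta> - 1 - L\<^sub>p)"
    and "W > 0"
    and "c1 = \<rho>Q * (1 - exp (- \<gamma> * h)
                    - (L\<^sub>f + L\<^sub>p * cost_norm f / (exp (\<gamma> * h) - 1)) * (h * L\<^sub>Q / (2 * \<beta> - 1 - L\<^sub>p)))
              - 2 * \<Lambda> * L\<^sub>Q / (W * (2 * \<beta> - 1 - L\<^sub>p))"
    and "c2 = 1 - \<Lambda> - W * \<rho>Q * h * (L\<^sub>f + L\<^sub>p * cost_norm f / (exp (\<gamma> * h) - 1))"
    and "c = min c1 c2"
    and "c > 0"
    and "C = 2 * h * \<Lambda> * L\<^sub>Q * cost_norm f / (c * (1 - exp (- \<gamma> * h)) * (2 * \<beta> - 1 - L\<^sub>p))"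
    and "\<And>k. L k = lyapunov W (mean_field_solutions p sel f \<gamma> h) (Q k) (\<mu> k) (\<mu>t k)"
  shows "(\<forall>k. \<exists>Qs \<in> mean_field_solutions p sel f \<gamma> h.
            \<forall>Qs' \<in> mean_field_solutions p sel f \<gamma> h.
              Q_norm (\<lambda>x a. Q k x a - Qs x a) \<le> Q_norm (\<lambda>x a. Q k x a - Qs' x a))
    \<and> (\<forall>k. L k \<le> (1 - c) ^ k * L 0
            + 2 * h * \<Lambda> * L\<^sub>Q * \<rho>Q * cost_norm f
                / (c * (1 - exp (- \<gamma> * h)) * (2 * \<beta> - 1 - L\<^sub>p)))
    \<and> limsup (\<lambda>k. ereal (L k)) \<le> ereal (C * \<rho>Q)"
proof -
  let ?e = "exp (- \<gamma> * h)"
  let ?F = "mean_field_solutions p sel f \<gamma> h"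
  note F = assms(5) and sel = assms(4) and P = assms(6)
  define D where "D = 2 * \<beta> - 1 - L\<^sub>p"
  define K where "K = L\<^sub>f + L\<^sub>p * cost_norm f / (exp (\<gamma> * h) - 1)"
  have Lp: "0 < L\<^sub>p" "L\<^sub>p < 1" and "0 < L\<^sub>Q" using P by (auto simp: assumption_P_def)
  have "0 < L\<^sub>f" using F by (simp add: assumption_F_def)
  have \<beta>: "(1 + L\<^sub>p) / 2 < \<beta>" "\<beta> < 1" using assms(7) by (auto simp: assumption_D_def)
  have "0 < D" using \<beta> by (simp add: D_def)
  have "L\<^sub>p < \<beta>" using \<beta> Lp by (simp add: field_simps)
  have e: "0 < ?e" "?e < 1" using assms(1,2) by auto
  have "0 < exp (\<gamma> * h) - 1" using assms(1,2) by simp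
  have cost: "0 \<le> cost_norm f"
    using abs_cost_le_cost_norm[OF F] abs_ge_zero order_trans by blast
  have "0 \<le> K" unfolding K_def
    using \<open>0 < L\<^sub>f\<close> Lp cost \<open>0 < exp (\<gamma> * h) - 1\<close> by simp
  have "\<rho>\<mu> * D < 1" using assms(12) \<open>0 < D\<close> by (simp add: D_def pos_less_divide_eq)
  then have "0 < \<Lambda>" by (simp add: assms(16) D_def)

  obtain \<nu> \<pi> where \<pi>0: "equilibrium p sel (Q 0) \<pi>"
    and minor0: "\<And>x x'. \<beta> * pmf \<nu> x' \<le> greedy_kernel p sel (Q 0) \<pi> x x'"
    using assms(7) unfolding assumption_D_def by metis
  have minor: "\<beta> * pmf \<nu> x' \<le> greedy_kernel p sel R \<pi> x x'" for R x x'
    using minor0[of x' x] greedy_kernel_independent[OF sel P, of R \<pi> "Q 0"] by simp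
  have \<pi>: "equilibrium p sel R \<pi>" for R
    using \<pi>0 greedy_kernel_independent[OF sel P, of R \<pi> "Q 0"] by (simp add: equilibrium_def)
  have eq: "equilibrium p sel R m \<longleftrightarrow> m = \<pi>" for R m
    using equilibrium_unique[OF sel P minor \<open>L\<^sub>p < \<beta>\<close> \<pi>] \<pi> by blast
  have \<mu>t: "\<mu>t k = \<pi>" for k using assms(9) eq by blast
  obtain S where S: "?F = {S}" "\<And>x a. S x a = bellman p f \<gamma> h \<pi> S x a"
    using mean_field_solutions_singleton[OF F assms(1,2) kernel_lipschitz[OF sel P] eq] by blast
  define d where "d k = Q_norm (\<lambda>x a. Q k x a - S x a)" for k
  define \<delta> where "\<delta> k = tv_dist (\<mu> k) \<pi>" for k
  have nonneg: "0 \<le> d k" "0 \<le> \<delta> k" for k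
    by (simp_all add: d_def \<delta>_def Q_norm_nonneg tv_dist_nonneg)
  have L: "L k = W * d k + \<delta> k" for k
    by (simp add: assms(23) lyapunov_def S(1) \<mu>t d_def \<delta>_def)

  have \<delta>_step: "\<delta> (Suc k) \<le> \<Lambda> * \<delta> k" for k
  proof -
    let ?P = "greedy_kernel p sel (Q k)"
    let ?u = "\<lambda>x. pmf (\<mu> k) x - pmf \<pi> x"
    let ?v = "\<lambda>x. push (\<mu> k) (?P (\<mu> k)) x - push \<pi> (?P \<pi>) x"
    have "pmf (\<mu> (Suc k)) x - pmf \<pi> x = (1 - \<rho>\<mu>) * ?u x + \<rho>\<mu> * ?v x" for x
    proof -
      have "pmf \<pi> x = push \<pi> (?P \<pi>) x"
        using \<pi>[of "Q k"] unfolding equilibrium_def by (rule fun_cong)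
      moreover have "pmf (\<mu> (Suc k)) x
          = pmf (\<mu> k) x + \<rho>\<mu> * (push (\<mu> k) (?P (\<mu> k)) x - pmf (\<mu> k) x)"
        using assms(8) by (simp add: two_timescale_iterates_def)
      ultimately show ?thesis by (simp add: algebra_simps)
    qed
    then have "\<delta> (Suc k) = tv_norm (\<lambda>x. (1 - \<rho>\<mu>) * ?u x + \<rho>\<mu> * ?v x)"
      by (simp add: \<delta>_def tv_dist_def)
    also have "\<dots> \<le> (1 - \<rho>\<mu>) * \<delta> k + \<rho>\<mu> * ((1 - \<beta> + L\<^sub>p) * \<delta> k)"
    proof (rule tv_norm_le)
      fix A
      have "\<bar>sum ?u A\<bar> \<le> \<delta> k" unfolding \<delta>_def tv_dist_def by (rule abs_sum_le_tv_norm)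
      then have 1: "\<bar>(1 - \<rho>\<mu>) * sum ?u A\<bar> \<le> (1 - \<rho>\<mu>) * \<delta> k"
        using assms(11) by (simp add: abs_mult mult_left_mono)
      have "\<bar>sum ?v A\<bar> \<le> (1 - \<beta> + L\<^sub>p) * \<delta> k"
        unfolding \<delta>_def
        by (rule order_trans[OF abs_sum_le_tv_norm push_contraction[OF sel P minor]])
      then have 2: "\<bar>\<rho>\<mu> * sum ?v A\<bar> \<le> \<rho>\<mu> * ((1 - \<beta> + L\<^sub>p) * \<delta> k)"
        using assms(10) by (simp add: abs_mult mult_left_mono)
      show "\<bar>\<Sum>x\<in>A. (1 - \<rho>\<mu>) * ?u x + \<rho>\<mu> * ?v x\<bar>
          \<le> (1 - \<rho>\<mu>) * \<delta> k + \<rho>\<mu> * ((1 - \<beta> + L\<^sub>p) * \<delta> k)"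
        unfolding sum.distrib sum_distrib_left[symmetric] using 1 2 by linarith
    qed
    also have "\<dots> \<le> (1 - \<rho>\<mu>) * \<delta> k + \<rho>\<mu> * ((1 - D) * \<delta> k)"
      using \<beta> assms(10) nonneg by (intro add_left_mono mult_left_mono mult_right_mono) (auto simp: D_def)
    also have "\<dots> = \<Lambda> * \<delta> k" by (simp add: assms(16) D_def algebra_simps)
    finally show ?thesis .
  qed

  have S_norm: "h * L\<^sub>f + ?e * L\<^sub>p * Q_norm S \<le> h * K"
  proof -
    have "?e * L\<^sub>p * Q_norm S \<le> ?e * L\<^sub>p * (h * cost_norm f / (1 - ?e))"
      using bellman_fixpoint_bound[OF F assms(1,2) S(2)] e Lp by (intro mult_left_mono) auto
    also have "\<dots> = h * (L\<^sub>p * cost_norm f * (?e / (1 - ?e)))" by simp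
    also have "?e / (1 - ?e) = 1 / (exp (\<gamma> * h) - 1)"
      using e \<open>0 < exp (\<gamma> * h) - 1\<close> by (simp add: exp_minus field_simps)
    finally show ?thesis by (simp add: K_def distrib_left)
  qed
  have d_step: "d (Suc k) \<le> (1 - \<rho>Q * (1 - ?e)) * d k + \<rho>Q * (h * K) * \<delta> k" for k
    unfolding d_def[of "Suc k"]
  proof (rule Q_norm_le)
    fix x a
    let ?b = "bellman p f \<gamma> h (\<mu> k) (Q k) x a - bellman p f \<gamma> h \<pi> S x a"
    have "Q (Suc k) x a = Q k x a + \<rho>Q * (bellman p f \<gamma> h (\<mu> k) (Q k) x a - Q k x a)"
      using assms(8) by (simp add: two_timescale_iterates_def)
    then have decomp: "Q (Suc k) x a - S x a = (1 - \<rho>Q) * (Q k x a - S x a) + \<rho>Q * ?b"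
      unfolding S(2)[of x a, symmetric] by (simp add: algebra_simps)
    have "\<bar>Q k x a - S x a\<bar> \<le> d k"
      unfolding d_def by (rule abs_le_Q_norm[of "\<lambda>x a. Q k x a - S x a"])
    then have 1: "\<bar>(1 - \<rho>Q) * (Q k x a - S x a)\<bar> \<le> (1 - \<rho>Q) * d k"
      using assms(14) by (simp add: abs_mult mult_left_mono)
    have "\<bar>?b\<bar> \<le> ?e * d k + (h * L\<^sub>f + ?e * L\<^sub>p * Q_norm S) * \<delta> k"
      unfolding d_def \<delta>_def by (rule bellman_lipschitz[OF F assms(2) kernel_lipschitz[OF sel P]])
    also have "\<dots> \<le> ?e * d k + h * K * \<delta> k"
      by (intro add_left_mono mult_right_mono S_norm nonneg)
    finally have 2: "\<bar>\<rho>Q * ?b\<bar> \<le> \<rho>Q * (?e * d k + h * K * \<delta> k)"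
      using assms(13) by (simp add: abs_mult mult_left_mono)
    show "\<bar>Q (Suc k) x a - S x a\<bar> \<le> (1 - \<rho>Q * (1 - ?e)) * d k + \<rho>Q * (h * K) * \<delta> k"
      unfolding decomp using 1 2 abs_triangle_ineq[of "(1 - \<rho>Q) * (Q k x a - S x a)" "\<rho>Q * ?b"]
      by (simp add: algebra_simps)
  qed

  have c1: "c \<le> \<rho>Q * (1 - ?e)"
  proof -
    have "0 \<le> \<rho>Q * (K * (h * L\<^sub>Q / D)) + 2 * \<Lambda> * L\<^sub>Q / (W * D)"
      using assms(2,13,17) \<open>0 \<le> K\<close> \<open>0 < L\<^sub>Q\<close> \<open>0 < D\<close> \<open>0 < \<Lambda>\<close> by simp
    moreover have "c1 = \<rho>Q * (1 - ?e) - (\<rho>Q * (K * (h * L\<^sub>Q / D)) + 2 * \<Lambda> * L\<^sub>Q / (W * D))"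
      unfolding assms(18) K_def D_def by (simp add: right_diff_distrib)
    ultimately show ?thesis using assms(20) by linarith
  qed
  have c2: "\<Lambda> + W * \<rho>Q * h * K \<le> 1 - c"
    using assms(19,20) unfolding K_def by linarith
  have "c < 1"
  proof -
    have "0 \<le> W * \<rho>Q * h * K" using assms(2,13,17) \<open>0 \<le> K\<close> by simp
    then show ?thesis using c2 \<open>0 < \<Lambda>\<close> by linarith
  qed
  have L_step: "L (Suc k) \<le> (1 - c) * L k" for k
  proof -
    have "L (Suc k) \<le> W * ((1 - \<rho>Q * (1 - ?e)) * d k + \<rho>Q * (h * K) * \<delta> k) + \<Lambda> * \<delta> k"
      unfolding L using d_step[of k] \<delta>_step[of k] assms(17)
      by (intro add_mono mult_left_mono) auto
    also have "\<dots> = W * ((1 - \<rho>Q * (1 - ?e)) * d k) + (\<Lambda> + W * \<rho>Q * h * K) * \<delta> k"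
      by (simp add: algebra_simps)
    also have "\<dots> \<le> W * ((1 - c) * d k) + (1 - c) * \<delta> k"
      using c1 c2 nonneg assms(17) by (intro add_mono mult_left_mono mult_right_mono) auto
    also have "\<dots> = (1 - c) * L k" by (simp add: L algebra_simps)
    finally show ?thesis .
  qed
  have L_bound: "L k \<le> (1 - c) ^ k * L 0" for k
  proof (induction k)
    case (Suc k)
    have "L (Suc k) \<le> (1 - c) * L k" by (rule L_step)
    also have "\<dots> \<le> (1 - c) * ((1 - c) ^ k * L 0)" using Suc \<open>c < 1\<close> by (intro mult_left_mono) auto
    finally show ?case by simp
  qed simp
  have "0 \<le> C" unfolding assms(22) D_def[symmetric]
    using assms(2,21) \<open>0 < \<Lambda>\<close> \<open>0 < L\<^sub>Q\<close> cost e \<open>0 < D\<close> by simp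
  then have "0 \<le> C * \<rho>Q" using assms(13) by simp
  have C: "C * \<rho>Q = 2 * h * \<Lambda> * L\<^sub>Q * \<rho>Q * cost_norm f / (c * (1 - ?e) * (2 * \<beta> - 1 - L\<^sub>p))"
    unfolding assms(22) by simp
  have "limsup (\<lambda>k. ereal (L k)) \<le> ereal 0"
  proof -
    have "(\<lambda>k. (1 - c) ^ k * L 0) \<longlonglongrightarrow> 0"
      using \<open>c < 1\<close> assms(21) by (intro tendsto_mult_left_zero LIMSEQ_power_zero) auto
    then have "(\<lambda>k. ereal ((1 - c) ^ k * L 0)) \<longlonglongrightarrow> ereal 0" by simp
    then have "limsup (\<lambda>k. ereal ((1 - c) ^ k * L 0)) = ereal 0"
      by (rule lim_imp_Limsup[OF sequentially_bot])
    moreover have "limsup (\<lambda>k. ereal (L k)) \<le> limsup (\<lambda>k. ereal ((1 - c) ^ k * L 0))"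
      using L_bound by (intro Limsup_mono) simp
    ultimately show ?thesis by simp
  qed
  then have "limsup (\<lambda>k. ereal (L k)) \<le> ereal (C * \<rho>Q)"
    using \<open>0 \<le> C * \<rho>Q\<close> order_trans by (metis ereal_less_eq(3))
  moreover have "L k \<le> (1 - c) ^ k * L 0 + C * \<rho>Q" for k
    using L_bound[of k] \<open>0 \<le> C * \<rho>Q\<close> by linarith
  ultimately show ?thesis unfolding C[symmetric] S(1) by simp
qed

end
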